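(* Let $b=(n_1,\ldots,n_m)$ be a block structure with $\sum_i n_i=N$, and let $A\in\mathbb{R}^{N\times N}$ be symmetric positive semidefinite with $A^{(i,i)}=I_{n_i}$ for all $i$. Let $X^*$ be an optimal solution of the semidefinite program $$\max_{X}\ \mathrm{trace}(AX)\quad\text{subject to}\quad \mathrm{trace}(X^{(i,i)})=1,\ i=1,\ldots,m,$$ where $X$ ranges over symmetric positive semidefinite $N\times N$ matrices. Let $x_k$ denote the $k$-th eigenvector of $X^*$ (eigenvalues in decreasing order), and assume $\|x_1^{(i)}\|>0$ for all $i=1,\ldots,m$. Let $\psi:=\mathrm{trace}(AX^* )$ and let $p:=\pi(x_1)^TA\,\pi(x_1)$ be the objective value of the projected vector $\pi(x_1)$. If $X^*$ can be expressed as $$X^*=\lambda_1x_1x_1^T+\lambda_2x_2x_2^T+\cdots+\lambda_Nx_Nx_N^T,$$ where each $x_i$ has unit length and $\lambda_1>1>\sum_{i=2}^N\lambda_i$, then $$\psi-p\le\left(\frac{1}{1-\sum_{i=2}^N\lambda_i}-1\right)m^2+\left(\sum_{i=2}^N\lambda_i\right)\|A\|_2.$$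
   Context: Block notation: for $b=(n_1,\ldots,n_m)$ with $\sum_i n_i=N$, a vector $x\in\mathbb{R}^N$ is split into consecutive sub-vectors $x^{(i)}\in\mathbb{R}^{n_i}$, and a matrix $M\in\mathbb{R}^{N\times N}$ into blocks $M^{(i,j)}\in\mathbb{R}^{n_i\times n_j}$. For $y\in\mathbb{R}^N$ with all $\|y^{(i)}\|\neq0$, define $\pi(y):=\left(\frac{y^{(1)}}{\|y^{(1)}\|},\ldots,\frac{y^{(m)}}{\|y^{(m)}\|}\right)\in\mathbb{R}^N$. $\|\cdot\|$ is the Euclidean norm and $\|A\|_2$ the spectral norm. The eigenvectors $x_k$ of the symmetric matrix $X^*$ are taken orthonormal, so the displayed expression for $X^*$ is its spectral decomposition (with all $\lambda_i\ge0$). *)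

theory Defs
  imports Complex_Main "Jordan_Normal_Form.Matrix" "Jordan_Normal_Form.Char_Poly"
begin

text \<open>
  Vectors and matrices have explicit dimensions, so that the block sizes may differ.
  A block structure \<open>(n\<^sub>1, \<dots>, n\<^sub>m)\<close> is a list of naturals with \<open>m = length b\<close> and
  \<open>N = sum_list b\<close>. All indices start at 0.
\<close>

definition vnorm :: "real vec \<Rightarrow> real" where
  "vnorm v = sqrt (v \<bullet> v)"

text \<open>The operator norm induced by the Euclidean norm.\<close>

definition spectral_norm :: "real mat \<Rightarrow> real" where
  "spectral_norm A = (SUP v \<in> {v \<in> carrier_vec (dim_col A). vnorm v = 1}. vnorm (A *\<^sub>v v))"

definition trace :: "real mat \<Rightarrow> real" where
  "trace A = (\<Sum>i < dim_row A. A $$ (i, i))"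

definition outer_prod :: "real vec \<Rightarrow> real vec \<Rightarrow> real mat" where
  "outer_prod v w = mat (dim_vec v) (dim_vec w) (\<lambda>(i, j). v $ i * w $ j)"

definition sym_psd :: "nat \<Rightarrow> real mat \<Rightarrow> bool" where
  "sym_psd n A \<longleftrightarrow> A \<in> carrier_mat n n \<and> transpose_mat A = A \<and>
     (\<forall>v \<in> carrier_vec n. 0 \<le> v \<bullet> (A *\<^sub>v v))"

definition block_offset :: "nat list \<Rightarrow> nat \<Rightarrow> nat" where
  "block_offset b i = sum_list (take i b)"

definition subvec :: "nat list \<Rightarrow> real vec \<Rightarrow> nat \<Rightarrow> real vec" where
  "subvec b x i = vec (b ! i) (\<lambda>k. x $ (block_offset b i + k))"

definition block :: "nat list \<Rightarrow> real mat \<Rightarrow> nat \<Rightarrow> nat \<Rightarrow> real mat" where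
  "block b M i j = mat (b ! i) (b ! j)
     (\<lambda>(k, l). M $$ (block_offset b i + k, block_offset b j + l))"

text \<open>The projection \<open>\<pi>\<close>; meaningful only if all sub-vectors of \<open>y\<close> are nonzero.\<close>

definition block_normalize :: "nat list \<Rightarrow> real vec \<Rightarrow> real vec" where
  "block_normalize b y =
     foldr (@\<^sub>v) (map (\<lambda>i. (1 / vnorm (subvec b y i)) \<cdot>\<^sub>v subvec b y i) [0..<length b]) vNil"

definition sdp_feasible :: "nat list \<Rightarrow> real mat \<Rightarrow> bool" where
  "sdp_feasible b X \<longleftrightarrow> sym_psd (sum_list b) X \<and> (\<forall>i < length b. trace (block b X i i) = 1)"

definition sdp_optimal :: "nat list \<Rightarrow> real mat \<Rightarrow> real mat \<Rightarrow> bool" where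
  "sdp_optimal b A X \<longleftrightarrow> sdp_feasible b X \<and>
     (\<forall>Y. sdp_feasible b Y \<longrightarrow> trace (A * Y) \<le> trace (A * X))"

end

theory Submission
  imports Defs
begin

text \<open>
  Put \<open>s = (\<Sum>k\<ge>2. \<lambda>\<^sub>k)\<close>. The terms \<open>k \<ge> 2\<close> of the spectral decomposition contribute at most
  \<open>s \<parallel>A\<parallel>\<^sub>2\<close> to \<open>\<psi>\<close>. The trace constraints give \<open>1 - s \<le> \<lambda>\<^sub>1 \<parallel>x\<^sub>1\<^sup>(\<^sup>i\<^sup>)\<parallel>\<^sup>2 \<le> 1\<close>, so \<open>\<surd>\<lambda>\<^sub>1 x\<^sub>1\<close> arises from
  \<open>\<pi>(x\<^sub>1)\<close> by scaling the \<open>i\<close>-th block with some \<open>c\<^sub>i \<in> [\<surd>(1 - s), 1]\<close>. As \<open>A\<close> is positive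
  semidefinite with identity diagonal blocks, the block entries of the quadratic form at
  \<open>\<pi>(x\<^sub>1)\<close> are bounded by 1, so the scaling changes the form by at most
  \<open>(\<Sum>i j. 1 - c\<^sub>i c\<^sub>j) \<le> s m\<^sup>2 \<le> (1 / (1 - s) - 1) m\<^sup>2\<close>.
\<close>

section \<open>Coordinate expansions of bilinear forms and matrix sums\<close>

lemma scalar_prod_mult_mat_vec:
  assumes "v \<in> carrier_vec n" "A \<in> carrier_mat n k" "w \<in> carrier_vec k"
  shows "v \<bullet> (A *\<^sub>v w) = (\<Sum>i<n. \<Sum>j<k. v $ i * A $$ (i, j) * w $ j)"
  using assms by (simp add: scalar_prod_def sum_distrib_left mult.assoc atLeast0LessThan)

text \<open>Bridge from the algebraic \<open>finsum\<close> of the spectral decomposition to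
  ordinary sums of entries. Closure is proved in the same induction because reading an entry of a
  matrix sum requires the dimensions of the partial sum.\<close>

lemma finsum_mat_closed_index:
  assumes "finite F" "\<And>k. k \<in> F \<Longrightarrow> M k \<in> carrier_mat r c"
  shows "finsum (module_mat TYPE('a :: comm_ring_1) r c) M F \<in> carrier_mat r c \<and>
    (\<forall>i<r. \<forall>j<c. finsum (module_mat TYPE('a) r c) M F $$ (i, j) = (\<Sum>k\<in>F. M k $$ (i, j)))"
  using assms
proof (induction F rule: finite_induct)
  case empty
  interpret abelian_group "module_mat TYPE('a) r c" by (rule abelian_group_mat)
  show ?case by (simp add: module_mat_simps)
next
  case (insert a F)
  interpret abelian_group "module_mat TYPE('a) r c" by (rule abelian_group_mat)
  have "finsum (module_mat TYPE('a) r c) M (insert a F) =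
      M a + finsum (module_mat TYPE('a) r c) M F"
    by (subst finsum_insert) (use insert in \<open>auto simp: module_mat_simps\<close>)
  moreover have "M a \<in> carrier_mat r c" using insert by simp
  ultimately show ?case using insert by auto
qed

section \<open>Block indices and concatenated vectors\<close>

text \<open>Offsets are prefix sums, so appending a block at the end leaves all earlier offsets
  unchanged; hence the induction from the right.\<close>

lemma sum_blocks:
  fixes f :: "nat \<Rightarrow> real"
  shows "(\<Sum>t<sum_list b. f t) = (\<Sum>i<length b. \<Sum>k<b ! i. f (block_offset b i + k))"
proof (induction b rule: rev_induct)
  case Nil
  show ?case by simp
next
  case (snoc a b)
  have "(\<Sum>t<sum_list b + a. f t) = (\<Sum>t<sum_list b. f t) + (\<Sum>k<a. f (sum_list b + k))"
    by (induction a) (simp_all add: add.assoc)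
  then show ?case using snoc by (simp add: block_offset_def nth_append)
qed

lemma block_index_less:
  assumes "i < length b" "k < b ! i"
  shows "block_offset b i + k < sum_list b"
proof -
  have "sum_list b = sum_list (take i b) + (b ! i + sum_list (drop (Suc i) b))"
    by (metis append_take_drop_id Cons_nth_drop_Suc assms(1) sum_list.Cons sum_list_append)
  then show ?thesis using assms by (simp add: block_offset_def)
qed

lemma dim_concat_vec: "dim_vec (foldr (@\<^sub>v) vs vNil) = sum_list (map dim_vec vs)"
  by (induction vs) auto

lemma index_concat_vec:
  assumes "i < length vs" "k < dim_vec (vs ! i)"
  shows "foldr (@\<^sub>v) vs vNil $ (block_offset (map dim_vec vs) i + k) = vs ! i $ k"
  using assms
proof (induction vs arbitrary: i)
  case Nil
  then show ?case by simp
next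
  case (Cons v vs)
  show ?case
  proof (cases i)
    case 0
    then show ?thesis using Cons.prems by (simp add: block_offset_def)
  next
    case (Suc j)
    \<comment> \<open>This keeps the shifted index inside the tail, as the lookup rule for
      \<open>@\<^sub>v\<close> demands.\<close>
    have "block_offset (map dim_vec vs) j + k < sum_list (map dim_vec vs)"
      using block_index_less[of j "map dim_vec vs" k] Cons.prems Suc by simp
    then show ?thesis
      using Cons.IH[of j] Cons.prems Suc
      by (simp add: block_offset_def dim_concat_vec add.assoc)
  qed
qed

section \<open>Blockwise scaling and its quadratic form\<close>

text \<open>One device for three kinds of vectors: \<open>y\<close> itself (all factors 1), its
  projection (factors \<open>1 / vnorm (subvec b y i)\<close>), and test vectors supported on two
  blocks.\<close>

definition block_scale :: "nat list \<Rightarrow> (nat \<Rightarrow> real) \<Rightarrow> real vec \<Rightarrow> real vec" where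
  "block_scale b c y = foldr (@\<^sub>v) (map (\<lambda>i. c i \<cdot>\<^sub>v subvec b y i) [0..<length b]) vNil"

lemma block_normalize_eq_block_scale:
  "block_normalize b y = block_scale b (\<lambda>i. 1 / vnorm (subvec b y i)) y"
  by (simp add: block_normalize_def block_scale_def)

lemma map_dim_block_scale:
  "map dim_vec (map (\<lambda>i. c i \<cdot>\<^sub>v subvec b y i) [0..<length b]) = b"
  by (rule nth_equalityI) (auto simp: subvec_def)

lemma block_scale_closed [simp]: "block_scale b c y \<in> carrier_vec (sum_list b)"
  using map_dim_block_scale[of c b y]
  by (intro carrier_vecI) (simp only: block_scale_def dim_concat_vec)

lemma index_block_scale:
  assumes "i < length b" "k < b ! i"
  shows "block_scale b c y $ (block_offset b i + k) = c i * y $ (block_offset b i + k)"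
  using index_concat_vec[of i "map (\<lambda>i. c i \<cdot>\<^sub>v subvec b y i) [0..<length b]" k] assms
  unfolding map_dim_block_scale block_scale_def[symmetric] by (simp add: subvec_def)

text \<open>The factors are constant on each block, so they leave the inner sums, and the form on N
  coordinates reduces to one on m block coefficients.\<close>

lemma block_form_expand:
  assumes "A \<in> carrier_mat (sum_list b) (sum_list b)"
  shows "block_scale b c y \<bullet> (A *\<^sub>v block_scale b d y) =
    (\<Sum>i<length b. \<Sum>j<length b. c i * d j * (subvec b y i \<bullet> (block b A i j *\<^sub>v subvec b y j)))"
proof -
  have form: "subvec b y i \<bullet> (block b A i j *\<^sub>v subvec b y j) =
      (\<Sum>k<b ! i. \<Sum>l<b ! j. y $ (block_offset b i + k) *
        A $$ (block_offset b i + k, block_offset b j + l) * y $ (block_offset b j + l))" for i j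
    by (subst scalar_prod_mult_mat_vec[of _ "b ! i" _ "b ! j"])
      (auto simp: subvec_def block_def intro!: sum.cong)
  have "block_scale b c y \<bullet> (A *\<^sub>v block_scale b d y) =
      (\<Sum>i<length b. \<Sum>k<b ! i. \<Sum>j<length b. \<Sum>l<b ! j.
        c i * d j * (y $ (block_offset b i + k) *
        A $$ (block_offset b i + k, block_offset b j + l) * y $ (block_offset b j + l)))"
    by (subst scalar_prod_mult_mat_vec[OF block_scale_closed assms block_scale_closed])
      (simp add: sum_blocks index_block_scale mult_ac)
  also have "\<dots> = (\<Sum>i<length b. \<Sum>j<length b. \<Sum>k<b ! i. \<Sum>l<b ! j.
        c i * d j * (y $ (block_offset b i + k) *
        A $$ (block_offset b i + k, block_offset b j + l) * y $ (block_offset b j + l)))"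
    by (rule sum.cong[OF refl], rule sum.swap)
  finally show ?thesis by (simp only: form sum_distrib_left)
qed

section \<open>Euclidean and spectral norm\<close>

lemma vnorm_nonneg [simp]: "0 \<le> vnorm v"
  by (simp add: vnorm_def scalar_prod_def sum_nonneg)

lemma vnorm_square: "(vnorm v)\<^sup>2 = v \<bullet> v"
  by (simp add: vnorm_def scalar_prod_def sum_nonneg)

text \<open>Cauchy-Schwarz for a unit vector: with \<open>t = vnorm w\<close>, the square of the
  norm of \<open>t v - w\<close> equals \<open>2 t (t - v \<bullet> w)\<close>. Dividing by
  \<open>t\<close> forces the separate case \<open>w = 0\<close>.\<close>

lemma scalar_prod_le_vnorm:
  assumes "v \<in> carrier_vec n" "w \<in> carrier_vec n" "vnorm v = 1"
  shows "v \<bullet> w \<le> vnorm w"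
proof (cases "vnorm w = 0")
  case True
  then have "(\<Sum>i<n. (w $ i)\<^sup>2) = 0"
    using vnorm_square[of w] assms
    by (simp add: scalar_prod_def power2_eq_square atLeast0LessThan)
  then have "w $ i = 0" if "i < n" for i
    using that by (simp add: sum_nonneg_eq_0_iff)
  then show ?thesis using assms True by (simp add: scalar_prod_def)
next
  case False
  define t where "t = vnorm w"
  have "t > 0" using False vnorm_nonneg[of w] unfolding t_def by linarith
  have "0 \<le> (\<Sum>i<n. (t * v $ i - w $ i)\<^sup>2)" by (simp add: sum_nonneg)
  also have "\<dots> = t\<^sup>2 * (v \<bullet> v) - 2 * t * (v \<bullet> w) + w \<bullet> w"
    using assms
    by (simp add: scalar_prod_def atLeast0LessThan power2_eq_square algebra_simps
        sum.distrib sum_subtractf sum_distrib_left)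
  also have "\<dots> = 2 * t * (t - v \<bullet> w)"
    using vnorm_square[of v] vnorm_square[of w] assms(3)
    by (simp add: t_def power2_eq_square algebra_simps)
  finally show ?thesis using \<open>t > 0\<close> by (simp add: t_def zero_le_mult_iff)
qed

lemma abs_index_le_vnorm:
  assumes "i < dim_vec v"
  shows "\<bar>v $ i\<bar> \<le> vnorm v"
proof -
  have "(v $ i)\<^sup>2 \<le> (\<Sum>j<dim_vec v. (v $ j)\<^sup>2)"
    by (rule member_le_sum) (use assms in auto)
  also have "\<dots> = (vnorm v)\<^sup>2"
    by (simp add: vnorm_square) (simp add: scalar_prod_def power2_eq_square atLeast0LessThan)
  finally show ?thesis using abs_le_square_iff[of "v $ i" "vnorm v"] by simp
qed

text \<open>A real supremum bounds its members only if the set is bounded above; a crude bound by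
  absolute row sums provides this.\<close>

lemma vnorm_mult_le_spectral_norm:
  assumes A: "A \<in> carrier_mat r n" and v: "v \<in> carrier_vec n" "vnorm v = 1"
  shows "vnorm (A *\<^sub>v v) \<le> spectral_norm A"
proof -
  have "vnorm (A *\<^sub>v w) \<le> sqrt (\<Sum>i<r. (\<Sum>j<n. \<bar>A $$ (i, j)\<bar>)\<^sup>2)"
    if w: "w \<in> carrier_vec n" "vnorm w = 1" for w
  proof -
    have entry: "\<bar>(A *\<^sub>v w) $ i\<bar> \<le> (\<Sum>j<n. \<bar>A $$ (i, j)\<bar>)" if "i < r" for i
    proof -
      have "(A *\<^sub>v w) $ i = (\<Sum>j<n. A $$ (i, j) * w $ j)"
        using that A w by (simp add: scalar_prod_def atLeast0LessThan)
      also have "\<bar>\<dots>\<bar> \<le> (\<Sum>j<n. \<bar>A $$ (i, j) * w $ j\<bar>)" by (rule sum_abs)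
      also have "\<dots> \<le> (\<Sum>j<n. \<bar>A $$ (i, j)\<bar>)"
        using abs_index_le_vnorm[of _ w] w
        by (intro sum_mono) (auto simp: abs_mult intro!: mult_left_le)
      finally show ?thesis .
    qed
    have "(A *\<^sub>v w) \<bullet> (A *\<^sub>v w) = (\<Sum>i<r. ((A *\<^sub>v w) $ i)\<^sup>2)"
      using A by (simp add: scalar_prod_def[of "A *\<^sub>v w"] power2_eq_square atLeast0LessThan)
    also have "\<dots> \<le> (\<Sum>i<r. (\<Sum>j<n. \<bar>A $$ (i, j)\<bar>)\<^sup>2)"
      using entry by (intro sum_mono) (simp flip: abs_le_square_iff add: sum_nonneg)
    finally show ?thesis unfolding vnorm_def by simp
  qed
  then have "bdd_above ((\<lambda>w. vnorm (A *\<^sub>v w)) ` {w \<in> carrier_vec n. vnorm w = 1})"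
    by (intro bdd_aboveI2) auto
  then show ?thesis
    unfolding spectral_norm_def using A v by (auto intro: cSUP_upper2)
qed

section \<open>Bounding the block entries of the form\<close>

text \<open>Restricted to two blocks, the form is a positive semidefinite 2 by 2 matrix whose
  diagonal entries are the squared block norms, since the diagonal blocks of \<open>A\<close> are
  identities.\<close>

lemma abs_block_form_le:
  assumes A: "sym_psd (sum_list b) A"
    and diag: "\<And>i. i < length b \<Longrightarrow> block b A i i = 1\<^sub>m (b ! i)"
    and pos: "\<And>i. i < length b \<Longrightarrow> 0 < vnorm (subvec b y i)"
    and i: "i < length b" and j: "j < length b"
  shows "\<bar>subvec b y i \<bullet> (block b A i j *\<^sub>v subvec b y j)\<bar> \<le>
    vnorm (subvec b y i) * vnorm (subvec b y j)"
proof -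
  let ?q = "\<lambda>i j. subvec b y i \<bullet> (block b A i j *\<^sub>v subvec b y j)"
  let ?n = "\<lambda>i. vnorm (subvec b y i)"
  have Ac: "A \<in> carrier_mat (sum_list b) (sum_list b)" using A by (simp add: sym_psd_def)
  have qd: "?q i i = (?n i)\<^sup>2" if "i < length b" for i
    using diag[OF that] by (simp add: vnorm_square subvec_def)
  show ?thesis
  proof (cases "i = j")
    case True
    then show ?thesis using qd[OF i] by (simp add: power2_eq_square)
  next
    case False
    have blk: "block b A k l \<in> carrier_mat (b ! k) (b ! l)" for k l by (simp add: block_def)
    have sv: "subvec b y k \<in> carrier_vec (b ! k)" for k by (simp add: subvec_def)
    \<comment> \<open>Symmetry merges the two cross terms of the 2 by 2 form into one.\<close>
    have sym: "?q j i = ?q i j"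
    proof -
      have Asym: "A $$ (s, t) = A $$ (t, s)" if "s < sum_list b" "t < sum_list b" for s t
        using A that Ac by (metis sym_psd_def index_transpose_mat(1) carrier_matD)
      have "block b A j i = transpose_mat (block b A i j)"
      proof (rule eq_matI)
        fix k l
        assume "k < dim_row (transpose_mat (block b A i j))" "l < dim_col (transpose_mat (block b A i j))"
        then have kl: "k < b ! j" "l < b ! i" by (auto simp: block_def)
        show "block b A j i $$ (k, l) = transpose_mat (block b A i j) $$ (k, l)"
          using Asym[OF block_index_less[OF j kl(1)] block_index_less[OF i kl(2)]] kl
          by (simp add: block_def)
      qed (simp_all add: block_def)
      moreover have "(transpose_mat (block b A i j) *\<^sub>v subvec b y i) \<bullet> subvec b y j = ?q i j"
        by (rule transpose_vec_mult_scalar[OF blk sv sv])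
      moreover have "?q j i = (block b A j i *\<^sub>v subvec b y i) \<bullet> subvec b y j"
        by (rule comm_scalar_prod[OF sv mult_mat_vec_carrier[OF blk sv]])
      ultimately show ?thesis by simp
    qed
    have form: "0 \<le> r\<^sup>2 * ?q i i + 2 * (r * s * ?q i j) + s\<^sup>2 * ?q j j" for r s
    proof -
      define c where "c = (\<lambda>k. if k = i then r else if k = j then s else 0)"
      have "0 \<le> block_scale b c y \<bullet> (A *\<^sub>v block_scale b c y)"
        using A by (simp add: sym_psd_def)
      also have "\<dots> = (\<Sum>k<length b. \<Sum>l<length b. c k * c l * ?q k l)"
        by (rule block_form_expand[OF Ac])
      also have "\<dots> = (\<Sum>k\<in>{i, j}. \<Sum>l\<in>{i, j}. c k * c l * ?q k l)"
        using i j by (intro sum.mono_neutral_cong_right) (auto simp: c_def intro!: sum.mono_neutral_cong_right)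
      also have "\<dots> = r\<^sup>2 * ?q i i + 2 * (r * s * ?q i j) + s\<^sup>2 * ?q j j"
        using False sym by (simp add: c_def power2_eq_square algebra_simps)
      finally show ?thesis .
    qed
    have ni: "?n i > 0" and nj: "?n j > 0" using pos i j by auto
    \<comment> \<open>These weights turn both diagonal terms into 1; the two signs of the second
      weight give the two sides of the absolute value.\<close>
    have "0 \<le> 2 + 2 * (1 / ?n i * (1 / ?n j) * ?q i j)"
      using form[of "1 / ?n i" "1 / ?n j"] ni nj qd[OF i] qd[OF j] by (simp add: power_divide)
    moreover have "0 \<le> 2 - 2 * (1 / ?n i * (1 / ?n j) * ?q i j)"
      using form[of "1 / ?n i" "- (1 / ?n j)"] ni nj qd[OF i] qd[OF j] by (simp add: power_divide)
    ultimately have "\<bar>?q i j / (?n i * ?n j)\<bar> \<le> 1" by simp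
    then show ?thesis using ni nj by (simp add: abs_divide abs_mult)
  qed
qed

theorem proposition3p5:
  fixes b :: "nat list" and m N :: nat
    and A Xopt :: "real mat"
    and x :: "nat \<Rightarrow> real vec" and lam :: "nat \<Rightarrow> real"
    and \<psi> p :: real
  assumes "length b = m" and "sum_list b = N"
    and "sym_psd N A"
    and "\<And>i. i < m \<Longrightarrow> block b A i i = 1\<^sub>m (b ! i)"
    and "sdp_optimal b A Xopt"
    and "\<And>k. k < N \<Longrightarrow> x k \<in> carrier_vec N"
    and "\<And>k. k < N \<Longrightarrow> eigenvector Xopt (x k) (lam k)"
    and "\<And>k l. k < N \<Longrightarrow> l < N \<Longrightarrow> x k \<bullet> x l = (if k = l then 1 else 0)"
    and "\<And>k l. k \<le> l \<Longrightarrow> l < N \<Longrightarrow> lam l \<le> lam k"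
    and "\<And>k. k < N \<Longrightarrow> 0 \<le> lam k"
    and "Xopt = finsum (module_mat TYPE(real) N N)
                  (\<lambda>k. lam k \<cdot>\<^sub>m outer_prod (x k) (x k)) {0..<N}"
    and "\<And>i. i < m \<Longrightarrow> 0 < vnorm (subvec b (x 0) i)"
    and "\<psi> = trace (A * Xopt)"
    and "p = block_normalize b (x 0) \<bullet> (A *\<^sub>v block_normalize b (x 0))"
    and "lam 0 > 1" and "1 > (\<Sum>k = 1..<N. lam k)"
  shows "\<psi> - p \<le> (1 / (1 - (\<Sum>k = 1..<N. lam k)) - 1) * (real m)\<^sup>2
                + (\<Sum>k = 1..<N. lam k) * spectral_norm A"
proof -
  define s where "s = (\<Sum>k = 1..<N. lam k)"
  define y where "y = x 0"
  define n where "n = (\<lambda>i. vnorm (subvec b y i))"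
  define q where "q = (\<lambda>i j. subvec b y i \<bullet> (block b A i j *\<^sub>v subvec b y j))"
  note len = assms(1) and sumb = assms(2) and xc = assms(6) and lam_nn = assms(10)
  have Ac: "A \<in> carrier_mat N N" using assms(3) by (simp add: sym_psd_def)
  have s0: "0 \<le> s" and s1: "s < 1"
    using lam_nn assms(16) by (auto simp: s_def intro!: sum_nonneg)
  have npos: "0 < n i" if "i < m" for i using assms(12) that by (simp add: n_def y_def)
  \<comment> \<open>Index 0 is the leading eigenpair. Without \<open>0 < N\<close> the right side
    would carry a spurious \<open>f 0\<close>.\<close>
  have split: "(\<Sum>k<N. f k) = f 0 + (\<Sum>k = 1..<N. f k)" if "0 < N" for f :: "nat \<Rightarrow> real"
    using that by (simp add: sum.atLeast_Suc_lessThan atLeast0LessThan[symmetric])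
  have Xc: "Xopt \<in> carrier_mat N N"
    and X: "Xopt $$ (i, j) = (\<Sum>k<N. lam k * (x k $ i * x k $ j))" if "i < N" "j < N" for i j
  proof -
    have "lam k \<cdot>\<^sub>m outer_prod (x k) (x k) \<in> carrier_mat N N" if "k < N" for k
      using xc[OF that] by (simp add: outer_prod_def)
    then have fin: "Xopt \<in> carrier_mat N N \<and> (\<forall>i<N. \<forall>j<N. Xopt $$ (i, j) =
        (\<Sum>k\<in>{0..<N}. (lam k \<cdot>\<^sub>m outer_prod (x k) (x k)) $$ (i, j)))"
      unfolding assms(11) by (intro finsum_mat_closed_index) auto
    then show "Xopt \<in> carrier_mat N N" ..
    have "Xopt $$ (i, j) = (\<Sum>k\<in>{0..<N}. (lam k \<cdot>\<^sub>m outer_prod (x k) (x k)) $$ (i, j))"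
      using fin that by blast
    also have "\<dots> = (\<Sum>k<N. lam k * (x k $ i * x k $ j))"
      unfolding atLeast0LessThan
    proof (rule sum.cong[OF refl])
      fix k assume "k \<in> {..<N}"
      then have "dim_vec (x k) = N" using xc[of k] by simp
      then show "(lam k \<cdot>\<^sub>m outer_prod (x k) (x k)) $$ (i, j) = lam k * (x k $ i * x k $ j)"
        using that by (simp add: outer_prod_def)
    qed
    finally show "Xopt $$ (i, j) = (\<Sum>k<N. lam k * (x k $ i * x k $ j))" .
  qed
  show ?thesis
  proof (cases "N = 0")
    case True
    \<comment> \<open>A block of size 0 has a sub-vector of norm 0, contrary to \<open>npos\<close>;
      so there are no blocks and both sides of the claim vanish.\<close>
    have "m = 0"
    proof (rule ccontr)
      assume "m \<noteq> 0"
      then have "b ! 0 = 0" using True sumb len by (metis in_set_conv_nth neq0_conv sum_list_eq_0_iff)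
      then show False using npos[of 0] \<open>m \<noteq> 0\<close> by (simp add: n_def vnorm_def scalar_prod_def subvec_def)
    qed
    then show ?thesis using True Ac assms(1,13,14)
      by (simp add: trace_def block_normalize_def scalar_prod_def)
  next
    case False
    then have N: "0 < N" by simp
    have unit: "x k \<bullet> x k = 1" if "k < N" for k using assms(8)[OF that that] by simp
    have blk_le: "(vnorm (subvec b (x k) i))\<^sup>2 \<le> 1" if "k < N" "i < m" for k i
    proof -
      have "(vnorm (subvec b (x k) i))\<^sup>2 \<le> (\<Sum>j<m. (vnorm (subvec b (x k) j))\<^sup>2)"
        by (rule member_le_sum) (use that in auto)
      also have "\<dots> = x k \<bullet> x k"
        using xc[OF that(1)] sum_blocks[of "\<lambda>t. x k $ t * x k $ t" b] len sumb
        by (simp add: vnorm_square) (simp add: scalar_prod_def subvec_def atLeast0LessThan)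
      finally show ?thesis using unit[OF that(1)] by simp
    qed
    \<comment> \<open>The trace constraint of block \<open>i\<close>, read through the spectral
      decomposition: the diagonal block of \<open>x\<^sub>k x\<^sub>k\<^sup>T\<close> has trace
      equal to the squared norm of that sub-vector.\<close>
    have tr: "lam 0 * (n i)\<^sup>2 + (\<Sum>k = 1..<N. lam k * (vnorm (subvec b (x k) i))\<^sup>2) = 1"
      if i: "i < m" for i
    proof -
      have "1 = trace (block b Xopt i i)"
        using assms(5) i len by (simp add: sdp_optimal_def sdp_feasible_def)
      also have "\<dots> = (\<Sum>t<b ! i. \<Sum>k<N. lam k * (x k $ (block_offset b i + t))\<^sup>2)"
        using X block_index_less[of i b] i len sumb
        by (simp add: trace_def block_def power2_eq_square)
      also have "\<dots> = (\<Sum>k<N. lam k * (vnorm (subvec b (x k) i))\<^sup>2)"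
        by (subst sum.swap)
          (simp add: vnorm_square, simp add: scalar_prod_def subvec_def power2_eq_square
            sum_distrib_left atLeast0LessThan)
      finally show ?thesis using split[OF N] by (simp add: n_def y_def)
    qed
    have upper: "lam 0 * (n i)\<^sup>2 \<le> 1" if i: "i < m" for i
    proof -
      have "0 \<le> (\<Sum>k = 1..<N. lam k * (vnorm (subvec b (x k) i))\<^sup>2)"
        using lam_nn by (intro sum_nonneg) auto
      then show ?thesis using tr[OF i] by linarith
    qed
    have lower: "1 - s \<le> lam 0 * (n i)\<^sup>2" if i: "i < m" for i
    proof -
      have "(\<Sum>k = 1..<N. lam k * (vnorm (subvec b (x k) i))\<^sup>2) \<le> s"
        unfolding s_def using lam_nn blk_le[OF _ i] by (intro sum_mono) (auto intro: mult_left_le)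
      then show ?thesis using tr[OF i] by linarith
    qed
    \<comment> \<open>\<open>lam 0 * (n i * n j)\<close> is the product
      \<open>c\<^sub>i c\<^sub>j\<close> of the scaling factors, kept free of square roots. The
      upper bound is the arithmetic-geometric mean inequality.\<close>
    have prod_upper: "lam 0 * (n i * n j) \<le> 1" if i: "i < m" and j: "j < m" for i j
    proof -
      have "2 * (n i * n j) \<le> (n i)\<^sup>2 + (n j)\<^sup>2"
        using sum_squares_bound[of "n i" "n j"] by simp
      then have "lam 0 * (2 * (n i * n j)) \<le> lam 0 * ((n i)\<^sup>2 + (n j)\<^sup>2)"
        using assms(15) by (intro mult_left_mono) auto
      then show ?thesis using upper[OF i] upper[OF j] by (simp add: algebra_simps)
    qed
    have prod_lower: "1 - s \<le> lam 0 * (n i * n j)" if i: "i < m" and j: "j < m" for i j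
    proof -
      \<comment> \<open>Multiplying the lower bounds for \<open>i\<close> and \<open>j\<close> gives
        the square of the wanted inequality.\<close>
      have "(1 - s) * (1 - s) \<le> (lam 0 * (n i)\<^sup>2) * (lam 0 * (n j)\<^sup>2)"
        using lower[OF i] lower[OF j] s1 by (intro mult_mono) auto
      then have "(1 - s)\<^sup>2 \<le> (lam 0 * (n i * n j))\<^sup>2" by (simp add: power2_eq_square mult_ac)
      then show ?thesis
        using npos[OF i] npos[OF j] assms(15) by (intro power2_le_imp_le[of "1 - s"]) auto
    qed
    have trAX: "\<psi> = (\<Sum>k<N. lam k * (x k \<bullet> (A *\<^sub>v x k)))"
    proof -
      have "\<psi> = (\<Sum>i<N. \<Sum>j<N. A $$ (i, j) * Xopt $$ (j, i))"
        using Ac Xc[OF N N]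
        by (simp add: assms(13) trace_def scalar_prod_def atLeast0LessThan)
      also have "\<dots> = (\<Sum>i<N. \<Sum>j<N. \<Sum>k<N. lam k * (x k $ i * A $$ (i, j) * x k $ j))"
        by (simp add: X sum_distrib_left mult_ac)
      also have "\<dots> = (\<Sum>i<N. \<Sum>k<N. \<Sum>j<N. lam k * (x k $ i * A $$ (i, j) * x k $ j))"
        by (rule sum.cong[OF refl], rule sum.swap)
      also have "\<dots> = (\<Sum>k<N. \<Sum>i<N. \<Sum>j<N. lam k * (x k $ i * A $$ (i, j) * x k $ j))"
        by (rule sum.swap)
      finally show ?thesis
        using xc Ac by (simp add: scalar_prod_mult_mat_vec[of _ N A N] sum_distrib_left)
    qed
    have tail: "(\<Sum>k = 1..<N. lam k * (x k \<bullet> (A *\<^sub>v x k))) \<le> s * spectral_norm A"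
      unfolding s_def sum_distrib_right
    proof (intro sum_mono mult_left_mono)
      fix k assume "k \<in> {1..<N}"
      then have k: "k < N" by simp
      have v: "vnorm (x k) = 1" using unit[OF k] by (simp add: vnorm_def)
      have "x k \<bullet> (A *\<^sub>v x k) \<le> vnorm (A *\<^sub>v x k)"
        by (rule scalar_prod_le_vnorm[of _ N]) (use xc k v Ac in auto)
      also have "\<dots> \<le> spectral_norm A"
        by (rule vnorm_mult_le_spectral_norm[OF Ac xc[OF k] v])
      finally show "x k \<bullet> (A *\<^sub>v x k) \<le> spectral_norm A" .
    qed (use lam_nn in auto)
    \<comment> \<open>Makes the block expansion available for \<open>y\<close> itself. A vanishing
      sum of absolute differences transfers equality from block indices to plain
      coordinates.\<close>
    have bs1: "block_scale b (\<lambda>_. 1) y = y"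
    proof -
      have "dim_vec y = N" using xc[OF N] by (simp add: y_def)
      have "(\<Sum>t<N. \<bar>block_scale b (\<lambda>_. 1) y $ t - y $ t\<bar>) = 0"
        using sum_blocks[of "\<lambda>t. \<bar>block_scale b (\<lambda>_. 1) y $ t - y $ t\<bar>" b] sumb
        by (simp add: index_block_scale)
      then show ?thesis
        using \<open>dim_vec y = N\<close> block_scale_closed[of b "\<lambda>_. 1" y] sumb
        by (intro eq_vecI) (auto simp: sum_nonneg_eq_0_iff)
    qed
    have form: "block_scale b c y \<bullet> (A *\<^sub>v block_scale b c y) =
        (\<Sum>i<m. \<Sum>j<m. c i * c j * q i j)" for c
      using block_form_expand[of A b c y c] Ac sumb len by (simp add: q_def)
    have head: "lam 0 * (y \<bullet> (A *\<^sub>v y)) - p \<le> s * (real m)\<^sup>2"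
    proof -
      have "lam 0 * (y \<bullet> (A *\<^sub>v y)) - p =
          (\<Sum>i<m. \<Sum>j<m. (lam 0 - 1 / (n i * n j)) * q i j)"
        using form[of "\<lambda>_. 1"] form[of "\<lambda>i. 1 / n i"]
        unfolding assms(14) block_normalize_eq_block_scale y_def[symmetric] n_def
        by (simp add: bs1 sum_distrib_left sum_subtractf left_diff_distrib)
      also have "\<dots> \<le> (\<Sum>i<m. \<Sum>j<m. s)"
      proof (intro sum_mono)
        fix i j assume "i \<in> {..<m}" "j \<in> {..<m}"
        then have i: "i < m" and j: "j < m" by auto
        have nn: "0 < n i * n j" using npos i j by simp
        have "\<bar>q i j\<bar> \<le> n i * n j"
          unfolding q_def n_def
          by (rule abs_block_form_le) (use assms(3,4) npos i j len sumb in \<open>auto simp: n_def\<close>)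
        \<comment> \<open>By \<open>prod_upper\<close> the factor is nonnegative, so only the lower
          bound \<open>- (n i * n j)\<close> on \<open>q i j\<close> matters.\<close>
        then have "(1 / (n i * n j) - lam 0) * (- q i j) \<le> (1 / (n i * n j) - lam 0) * (n i * n j)"
          using prod_upper[OF i j] nn by (intro mult_left_mono) (auto simp: field_simps)
        also have "\<dots> = 1 - lam 0 * (n i * n j)" using npos[OF i] npos[OF j] by (simp add: field_simps)
        also have "\<dots> \<le> s" using prod_lower[OF i j] by simp
        finally show "(lam 0 - 1 / (n i * n j)) * q i j \<le> s" by (simp add: algebra_simps)
      qed
      finally show ?thesis by (simp add: power2_eq_square mult_ac)
    qed
    \<comment> \<open>Relaxes the bound \<open>s * (real m)\<^sup>2\<close> to the stated one,
      because \<open>(1 + s) (1 - s) = 1 - s\<^sup>2\<close>.\<close>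
    have "s \<le> 1 / (1 - s) - 1"
    proof -
      have "(s + 1) * (1 - s) \<le> 1" by (simp add: algebra_simps)
      then have "s + 1 \<le> 1 / (1 - s)" using s1 by (simp add: pos_le_divide_eq)
      then show ?thesis by simp
    qed
    then have "s * (real m)\<^sup>2 \<le> (1 / (1 - s) - 1) * (real m)\<^sup>2"
      by (intro mult_right_mono) auto
    then show ?thesis
      using head tail trAX split[OF N] by (simp add: y_def s_def)
  qed
qed

end
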